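(* For fixed $\mu>0$, the profit $g(\mu,\sigma)$ has the following asymptotic behaviour: (i) $g(\mu,\sigma)=e^{\sigma^2-\mu}+o(1/\sigma)$ as $\sigma\to\infty$; (ii) $g(\mu,\sigma)=e^{-\mu}+(1-e^{-\mu})\Phi(\mu/\sigma)+o(\sigma)$ as $\sigma\to 0+$.
   Context: $\Phi$ is the standard normal cumulative distribution function. For $\mu,\sigma>0$ the normal censor $W=W(\mu,\sigma)$ is the unique real solution $W$ of $$e^{-\mu}=\Phi(W-\sigma)+e^{\sigma W-\frac12\sigma^2}\Phi(-W).$$ The profit function (for the Cobb-Douglas revenue $f(x)=2\sqrt x$) is $$g(\mu,\sigma)=e^{\sigma^2-\mu}\Phi(W+\sigma)+e^{-\mu-\sigma W+\frac12\sigma^2}\Phi(-W),\qquad W=W(\mu,\sigma).$$ *)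

theory Defs
  imports "HOL-Probability.Probability" "HOL-Library.Landau_Symbols"
begin

definition Phi :: "real \<Rightarrow> real" where
  "Phi x = cdf std_normal_distribution x"

(* Meaningful for mu > 0 and sigma > 0 only, where the equation has exactly one real solution:
   its right-hand side is strictly increasing in w, with limits 0 and 1. *)
definition normal_censor :: "real \<Rightarrow> real \<Rightarrow> real" where
  "normal_censor \<mu> \<sigma> =
     (THE w. exp (- \<mu>) = Phi (w - \<sigma>) + exp (\<sigma> * w - \<sigma>\<^sup>2 / 2) * Phi (- w))"

definition profit :: "real \<Rightarrow> real \<Rightarrow> real" where
  "profit \<mu> \<sigma> =
     (let W = normal_censor \<mu> \<sigma>
      in exp (\<sigma>\<^sup>2 - \<mu>) * Phi (W + \<sigma>) + exp (- \<mu> - \<sigma> * W + \<sigma>\<^sup>2 / 2) * Phi (- W))"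

end

theory Submission
  imports Defs "HOL-Real_Asymp.Real_Asymp"
begin

text \<open>
  Both error terms are in fact exponentially small, because in either regime the censor
  \<open>W\<close> lies far enough from the centre of the distribution for the Gaussian tail bound
  \<open>\<Phi>(x) \<le> exp (-x\<^sup>2/2)\<close> (\<open>x \<le> 0\<close>, lemma \<open>Phi_le_exp\<close>) to absorb every
  exponential factor in the profit.

  Write \<open>F(w)\<close> for the right-hand side of the censor equation \<open>F(W) = exp (-\<mu>)\<close>. Its
  derivative simplifies to \<open>\<sigma> exp (\<sigma> w - \<sigma>\<^sup>2/2) \<Phi>(-w) > 0\<close>, so \<open>F\<close> is
  strictly increasing. Hence \<open>W\<close> is well defined, and to compare it with a trial point \<open>w\<close>
  it is enough to compare \<open>F(w)\<close> with \<open>exp (-\<mu>)\<close>.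

  For large \<open>\<sigma>\<close> the trial point is \<open>\<sigma>/2\<close>, where \<open>F\<close> is
  \<open>2 \<Phi>(-\<sigma>/2) \<rightarrow> 0\<close>, so \<open>W > \<sigma>/2\<close> eventually. The difference between
  \<open>g\<close> and \<open>exp (\<sigma>\<^sup>2 - \<mu>)\<close> consists of two terms, each at most
  \<open>exp (\<sigma>\<^sup>2 - (W + \<sigma>)\<^sup>2/2) \<le> exp (-\<sigma>\<^sup>2/8)\<close>.

  For small \<open>\<sigma>\<close> the trial point is \<open>-\<mu>/(2\<sigma>)\<close>, where \<open>F\<close> is at least a
  quantity tending to \<open>exp (-\<mu>/2) > exp (-\<mu>)\<close>, so \<open>W < -\<mu>/(2\<sigma>)\<close> eventually.
  The first term of \<open>g\<close> is then a tail. Replacing \<open>exp (-\<mu>)\<close> in the second term by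
  \<open>F(W)\<close> cancels the exponential weight and leaves \<open>\<Phi>(-W)\<^sup>2\<close> plus a tail. So
  \<open>g = 1\<close> up to an exponentially small error, and the same is true of the claimed main term,
  since \<open>\<Phi>(\<mu>/\<sigma>)\<close> is exponentially close to \<open>1\<close>.
\<close>

section \<open>The standard normal distribution function\<close>

interpretation std_normal: real_distribution std_normal_distribution
  by (rule real_dist_normal_dist)

lemma Phi_nonneg: "0 \<le> Phi x"
  by (simp add: Phi_def std_normal.cdf_nonneg)

lemma Phi_at_bot: "(Phi \<longlongrightarrow> 0) at_bot"
  unfolding Phi_def[abs_def] by (rule std_normal.cdf_lim_at_bot)

lemma Phi_at_top: "(Phi \<longlongrightarrow> 1) at_top"
  unfolding Phi_def[abs_def] by (rule std_normal.cdf_lim_at_top_prob)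

lemma Phi_diff_eq_integral:
  assumes "a < x"
  shows "Phi x = Phi a + integral {a..x} std_normal_density"
proof -
  have int: "set_integrable lborel {a..x} std_normal_density"
    by (rule borel_integrable_atLeastAtMost') (auto simp: std_normal_density_def intro!: continuous_intros)
  have "Phi x - Phi a = measure std_normal_distribution {a<..x}"
    unfolding Phi_def using std_normal.cdf_diff_eq[OF assms] by simp
  also have "\<dots> = (LINT t|std_normal_distribution. indicator {a<..x} t)"
    by simp
  also have "\<dots> = (LINT t|lborel. std_normal_density t *\<^sub>R indicator {a<..x} t)"
    by (rule integral_density) auto
  also have "\<dots> = (LINT t:{a..x}|lborel. std_normal_density t)"
    unfolding set_lebesgue_integral_def
  proof (rule integral_cong_AE)
    show "AE t in lborel. std_normal_density t *\<^sub>R indicator {a<..x} t =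
            indicator {a..x} t *\<^sub>R std_normal_density t"
      using AE_lborel_singleton[of a] by eventually_elim (auto simp: indicator_def)
  qed auto
  also have "\<dots> = integral {a..x} std_normal_density"
    using int by (rule set_borel_integral_eq_integral)
  finally show ?thesis by simp
qed

lemma Phi_has_derivative:
  "(Phi has_real_derivative std_normal_density x) (at x)"
proof -
  have cont: "continuous_on {x - 1..x + 1} std_normal_density"
    by (auto simp: std_normal_density_def intro!: continuous_intros)
  have "((\<lambda>u. integral {x - 1..u} std_normal_density) has_real_derivative std_normal_density x)
          (at x within {x - 1..x + 1})"
    by (rule integral_has_real_derivative[OF cont]) simp
  then have "((\<lambda>u. integral {x - 1..u} std_normal_density) has_real_derivative std_normal_density x)
          (at x)"
    by (simp add: at_within_Icc_at)
  then have "((\<lambda>u. Phi (x - 1) + integral {x - 1..u} std_normal_density)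
               has_real_derivative std_normal_density x) (at x)"
    by (auto intro!: derivative_eq_intros)
  then show ?thesis
  proof (rule has_field_derivative_transform_within_open)
    show "open {x - 1<..}" by simp
  qed (simp_all add: Phi_diff_eq_integral)
qed

text \<open>
  The density is even, so \<open>\<Phi>(x) + \<Phi>(-x)\<close> has derivative zero; its limit at infinity
  identifies the constant.
\<close>

lemma Phi_minus: "Phi (- x) = 1 - Phi x"
proof -
  have "((\<lambda>x. Phi x + Phi (- x)) has_real_derivative 0) (at x)" for x
    by (auto intro!: derivative_eq_intros DERIV_chain2[OF Phi_has_derivative]
        simp: std_normal_density_def)
  then obtain c where c: "Phi x + Phi (- x) = c" for x
    using DERIV_const_ratio_const[of _ _ "\<lambda>x. Phi x + Phi (- x)" 0]
    by (metis DERIV_isconst_all)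
  have "((\<lambda>x. Phi x + Phi (- x)) \<longlongrightarrow> 1 + 0) at_top"
    by (intro tendsto_add Phi_at_top filterlim_compose[OF Phi_at_bot]
        filterlim_uminus_at_bot_at_top)
  then have "c = 1" unfolding c by (simp add: tendsto_const_iff)
  then show ?thesis using c[of x] by simp
qed

lemma Phi_le_1: "Phi x \<le> 1"
  using Phi_minus[of x] Phi_nonneg[of "-x"] by simp

text \<open>Strict positivity makes the censor function below strictly, not just weakly, increasing.\<close>

lemma Phi_pos: "0 < Phi x"
proof -
  have "Phi (x - 1) < Phi x"
    by (rule DERIV_pos_imp_increasing[where f = Phi]) (auto intro!: exI Phi_has_derivative simp: std_normal_density_def)
  then show ?thesis using Phi_nonneg[of "x - 1"] by linarith
qed

text \<open>
  Shifting the normal law by \<open>x\<close> multiplies its density by an exponential factor that is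
  bounded by \<open>exp (-x\<^sup>2/2)\<close> on the half line to the left of \<open>x\<close>. In terms of
  distribution functions, \<open>exp (-x\<^sup>2/2) \<Phi>(t - x) - \<Phi>(t)\<close> is nondecreasing for
  \<open>t \<le> x\<close>; it vanishes at minus infinity, so it is nonnegative at \<open>t = x\<close>.
\<close>

lemma Phi_le_exp:
  assumes "x \<le> 0"
  shows "Phi x \<le> exp (- x\<^sup>2 / 2)"
proof -
  let ?H = "\<lambda>t. exp (- x\<^sup>2 / 2) * Phi (t - x) - Phi t"
  have mono: "?H t \<le> ?H x" if "t \<le> x" for t
  proof (rule DERIV_nonneg_imp_nondecreasing[OF that])
    fix u assume "u \<le> x"
    have "(?H has_real_derivative
            exp (- x\<^sup>2 / 2) * std_normal_density (u - x) - std_normal_density u) (at u)"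
      by (auto intro!: derivative_eq_intros DERIV_chain2[OF Phi_has_derivative])
    moreover have "exp (- x\<^sup>2 / 2) * std_normal_density (u - x) =
        std_normal_density u * exp (x * (u - x))"
      by (simp add: std_normal_density_def exp_add[symmetric] power2_eq_square field_simps)
    moreover have "x * (u - x) \<ge> 0"
      using assms \<open>u \<le> x\<close> by (simp add: mult_nonpos_nonpos)
    then have "std_normal_density u * 1 \<le> std_normal_density u * exp (x * (u - x))"
      by (intro mult_left_mono) auto
    ultimately show "\<exists>y. (?H has_real_derivative y) (at u) \<and> 0 \<le> y"
      by (intro exI[of _ "exp (- x\<^sup>2 / 2) * std_normal_density (u - x) - std_normal_density u"]) auto
  qed
  have "filterlim (\<lambda>t. t - x) at_bot at_bot"
    by real_asymp
  then have "(?H \<longlongrightarrow> exp (- x\<^sup>2 / 2) * 0 - 0) at_bot"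
    by (intro tendsto_diff tendsto_mult tendsto_const filterlim_compose[OF Phi_at_bot] Phi_at_bot)
  moreover have "eventually (\<lambda>t. ?H t \<le> ?H x) at_bot"
    using eventually_le_at_bot[of x] by eventually_elim (rule mono)
  ultimately have "exp (- x\<^sup>2 / 2) * 0 - 0 \<le> ?H x"
    by (rule tendsto_upperbound) simp
  then have "Phi x \<le> exp (- x\<^sup>2 / 2) * Phi 0" by simp
  also have "\<dots> \<le> exp (- x\<^sup>2 / 2) * 1"
    by (intro mult_left_mono Phi_le_1) simp
  finally show ?thesis by simp
qed

section \<open>The censor equation\<close>

text \<open>
  For a standard normal \<open>Z\<close> this is the mean of
  \<open>exp (\<sigma> min(Z, w) - \<sigma>\<^sup>2/2)\<close>, a log-normal variable censored from above at the
  level belonging to \<open>w\<close>.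
\<close>

definition censor_fun :: "real \<Rightarrow> real \<Rightarrow> real" where
  "censor_fun \<sigma> w = Phi (w - \<sigma>) + exp (\<sigma> * w - \<sigma>\<^sup>2 / 2) * Phi (- w)"

text \<open>
  Only the weight \<open>exp (\<sigma> w - \<sigma>\<^sup>2/2)\<close> contributes to the derivative: the two density
  terms cancel, because that weight is exactly the ratio of the shifted density to the original one.
\<close>

lemma censor_fun_has_derivative:
  "(censor_fun \<sigma> has_real_derivative \<sigma> * exp (\<sigma> * w - \<sigma>\<^sup>2 / 2) * Phi (- w)) (at w)"
proof -
  have tilt: "std_normal_density (w - \<sigma>) = exp (\<sigma> * w - \<sigma>\<^sup>2 / 2) * std_normal_density (- w)"
    by (simp add: std_normal_density_def exp_add[symmetric] power2_eq_square field_simps)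
  show ?thesis
    unfolding censor_fun_def[abs_def]
    by (auto intro!: derivative_eq_intros DERIV_chain2[OF Phi_has_derivative] simp: tilt)
qed

lemma censor_fun_strict_mono:
  assumes "\<sigma> > 0"
  shows "strict_mono (censor_fun \<sigma>)"
proof (rule strict_monoI)
  fix a b :: real assume "a < b"
  moreover have "0 < \<sigma> * exp (\<sigma> * w - \<sigma>\<^sup>2 / 2) * Phi (- w)" for w
    using assms Phi_pos by simp
  ultimately show "censor_fun \<sigma> a < censor_fun \<sigma> b"
    using DERIV_pos_imp_increasing censor_fun_has_derivative by metis
qed

lemma censor_fun_at_bot:
  assumes "\<sigma> > 0"
  shows "(censor_fun \<sigma> \<longlongrightarrow> 0) at_bot"
proof -
  have "filterlim (\<lambda>w. w - \<sigma>) at_bot at_bot"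
    by real_asymp
  moreover have "filterlim uminus at_top (at_bot :: real filter)"
    by (rule filterlim_uminus_at_top_at_bot)
  moreover have "((\<lambda>w. exp (\<sigma> * w - \<sigma>\<^sup>2 / 2)) \<longlongrightarrow> 0) at_bot"
    using assms by real_asymp
  ultimately have "(censor_fun \<sigma> \<longlongrightarrow> 0 + 0 * 1) at_bot"
    unfolding censor_fun_def[abs_def]
    by (intro tendsto_add tendsto_mult filterlim_compose[OF Phi_at_bot]
        filterlim_compose[OF Phi_at_top])
  then show ?thesis by simp
qed

text \<open>
  Existence comes from the intermediate value theorem, between the limit \<open>0\<close> on the left
  and the lower bound \<open>\<Phi>(w - \<sigma>) \<rightarrow> 1\<close> on the right; uniqueness from strict
  monotonicity.
\<close>

lemma normal_censor_eq:
  assumes "\<mu> > 0" "\<sigma> > 0"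
  shows "censor_fun \<sigma> (normal_censor \<mu> \<sigma>) = exp (- \<mu>)"
proof -
  have "eventually (\<lambda>w. censor_fun \<sigma> w < exp (- \<mu>)) at_bot"
    using censor_fun_at_bot[OF assms(2)] by (rule order_tendstoD) simp
  then obtain a where a: "censor_fun \<sigma> a < exp (- \<mu>)"
    by (auto simp: eventually_at_bot_linorder)
  have "filterlim (\<lambda>w. w - \<sigma>) at_top at_top"
    by real_asymp
  then have "((\<lambda>w. Phi (w - \<sigma>)) \<longlongrightarrow> 1) at_top"
    by (rule filterlim_compose[OF Phi_at_top])
  then have "eventually (\<lambda>w. exp (- \<mu>) < Phi (w - \<sigma>)) at_top"
    by (rule order_tendstoD) (use assms in simp)
  then obtain b where "exp (- \<mu>) < Phi (b - \<sigma>)"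
    by (auto simp: eventually_at_top_linorder)
  also have "\<dots> \<le> censor_fun \<sigma> b"
    by (simp add: censor_fun_def Phi_nonneg)
  finally have b: "exp (- \<mu>) < censor_fun \<sigma> b" .
  have "a < b"
    using a b strict_mono_less[OF censor_fun_strict_mono[OF assms(2)]] by fastforce
  moreover have "continuous_on {a..b} (censor_fun \<sigma>)"
    by (intro continuous_at_imp_continuous_on ballI DERIV_isCont[OF censor_fun_has_derivative])
  ultimately obtain w where w: "censor_fun \<sigma> w = exp (- \<mu>)"
    using IVT'[of "censor_fun \<sigma>" a "exp (- \<mu>)" b] a b by auto
  have "normal_censor \<mu> \<sigma> = w"
    unfolding normal_censor_def
  proof (rule the_equality)
    fix v assume "exp (- \<mu>) = Phi (v - \<sigma>) + exp (\<sigma> * v - \<sigma>\<^sup>2 / 2) * Phi (- v)"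
    then show "v = w"
      using w strict_mono_eq[OF censor_fun_strict_mono[OF assms(2)]]
      by (metis censor_fun_def)
  qed (use w in \<open>simp add: censor_fun_def\<close>)
  then show ?thesis using w by simp
qed

lemma less_normal_censor_iff:
  assumes "\<mu> > 0" "\<sigma> > 0"
  shows "w < normal_censor \<mu> \<sigma> \<longleftrightarrow> censor_fun \<sigma> w < exp (- \<mu>)"
  using strict_mono_less[OF censor_fun_strict_mono[OF assms(2)]] normal_censor_eq[OF assms] by metis

lemma normal_censor_less_iff:
  assumes "\<mu> > 0" "\<sigma> > 0"
  shows "normal_censor \<mu> \<sigma> < w \<longleftrightarrow> exp (- \<mu>) < censor_fun \<sigma> w"
  using strict_mono_less[OF censor_fun_strict_mono[OF assms(2)]] normal_censor_eq[OF assms] by metis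

text \<open>
  At \<open>w = \<sigma>/2\<close> the exponential weight of the censor function equals \<open>1\<close> and both
  of its terms are the same tail.
\<close>

lemma eventually_normal_censor_gt:
  assumes "\<mu> > 0"
  shows "eventually (\<lambda>\<sigma>. \<sigma> / 2 < normal_censor \<mu> \<sigma>) at_top"
proof -
  have eq: "censor_fun \<sigma> (\<sigma> / 2) = 2 * Phi (- \<sigma> / 2)" for \<sigma>
    by (simp add: censor_fun_def power2_eq_square)
  have "filterlim (\<lambda>\<sigma>::real. - \<sigma> / 2) at_bot at_top"
    by real_asymp
  then have "((\<lambda>\<sigma>. 2 * Phi (- \<sigma> / 2)) \<longlongrightarrow> 2 * 0) at_top"
    by (intro tendsto_mult tendsto_const filterlim_compose[OF Phi_at_bot])
  then have "eventually (\<lambda>\<sigma>. 2 * Phi (- \<sigma> / 2) < exp (- \<mu>)) at_top"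
    by (rule order_tendstoD) simp
  then show ?thesis
    using eventually_gt_at_top[of 0]
    by eventually_elim (simp only: less_normal_censor_iff assms eq)
qed

text \<open>
  As \<open>\<sigma>\<close> tends to zero, \<open>\<sigma> W\<close> tends to \<open>-\<mu>\<close>. Any fixed fraction of
  \<open>-\<mu>/\<sigma>\<close> is therefore an upper bound for \<open>W\<close>; one half is enough here.
\<close>

lemma eventually_normal_censor_less:
  assumes "\<mu> > 0"
  shows "eventually (\<lambda>\<sigma>. normal_censor \<mu> \<sigma> < - \<mu> / (2 * \<sigma>)) (at_right 0)"
proof -
  have "filterlim (\<lambda>\<sigma>. \<mu> / (2 * \<sigma>)) at_top (at_right 0)"
    using assms by real_asymp
  moreover have "((\<lambda>\<sigma>. exp (- \<mu> / 2 - \<sigma>\<^sup>2 / 2)) \<longlongrightarrow> exp (- \<mu> / 2)) (at_right 0)"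
    by real_asymp
  ultimately have "((\<lambda>\<sigma>. exp (- \<mu> / 2 - \<sigma>\<^sup>2 / 2) * Phi (\<mu> / (2 * \<sigma>)))
                     \<longlongrightarrow> exp (- \<mu> / 2) * 1) (at_right 0)"
    by (intro tendsto_mult filterlim_compose[OF Phi_at_top])
  then have "eventually (\<lambda>\<sigma>. exp (- \<mu>) < exp (- \<mu> / 2 - \<sigma>\<^sup>2 / 2) * Phi (\<mu> / (2 * \<sigma>)))
               (at_right 0)"
    by (rule order_tendstoD) (use assms in simp)
  then show ?thesis
    using eventually_at_right_less[of 0]
  proof eventually_elim
    case (elim \<sigma>)
    have "exp (- \<mu> / 2 - \<sigma>\<^sup>2 / 2) * Phi (\<mu> / (2 * \<sigma>)) \<le> censor_fun \<sigma> (- \<mu> / (2 * \<sigma>))"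
      using elim Phi_nonneg by (simp add: censor_fun_def)
    then show ?case
      using elim by (simp add: normal_censor_less_iff assms)
  qed
qed

section \<open>Explicit bounds for the profit\<close>

text \<open>
  By completing the square, both error terms are bounded by
  \<open>exp (\<sigma>\<^sup>2 - \<mu> - (W + \<sigma>)\<^sup>2/2)\<close>. The hypothesis gives
  \<open>W + \<sigma> \<ge> 3\<sigma>/2\<close>, and \<open>(3/2)\<^sup>2/2 = 9/8\<close> exceeds \<open>1\<close>, so the
  Gaussian factor wins against \<open>exp (\<sigma>\<^sup>2)\<close> with \<open>1/8\<close> to spare.
\<close>

lemma profit_large_volatility_bound:
  assumes "\<mu> > 0" "\<sigma> > 0" "\<sigma> / 2 \<le> normal_censor \<mu> \<sigma>"
  shows "\<bar>profit \<mu> \<sigma> - exp (\<sigma>\<^sup>2 - \<mu>)\<bar> \<le> exp (- \<sigma>\<^sup>2 / 8)"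
proof -
  define W where "W = normal_censor \<mu> \<sigma>"
  have "(3 / 2 * \<sigma>)\<^sup>2 \<le> (W + \<sigma>)\<^sup>2"
    by (rule power_mono) (use assms in \<open>auto simp: W_def\<close>)
  then have small: "\<sigma>\<^sup>2 - \<mu> - (W + \<sigma>)\<^sup>2 / 2 \<le> - \<sigma>\<^sup>2 / 8"
    using assms(1) by (simp add: power2_eq_square)
  have "exp (\<sigma>\<^sup>2 - \<mu>) * Phi (- (W + \<sigma>)) \<le> exp (\<sigma>\<^sup>2 - \<mu>) * exp (- (- (W + \<sigma>))\<^sup>2 / 2)"
    by (intro mult_left_mono Phi_le_exp) (use assms in \<open>auto simp: W_def\<close>)
  also have "\<dots> = exp (\<sigma>\<^sup>2 - \<mu> - (W + \<sigma>)\<^sup>2 / 2)"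
    by (simp only: exp_add[symmetric] power2_minus) simp
  finally have 1: "exp (\<sigma>\<^sup>2 - \<mu>) * Phi (- (W + \<sigma>)) \<le> exp (- \<sigma>\<^sup>2 / 8)"
    using small by (meson exp_le_cancel_iff order_trans)
  have "exp (- \<mu> - \<sigma> * W + \<sigma>\<^sup>2 / 2) * Phi (- W) \<le>
        exp (- \<mu> - \<sigma> * W + \<sigma>\<^sup>2 / 2) * exp (- (- W)\<^sup>2 / 2)"
    by (intro mult_left_mono Phi_le_exp) (use assms in \<open>auto simp: W_def\<close>)
  also have "\<dots> = exp (\<sigma>\<^sup>2 - \<mu> - (W + \<sigma>)\<^sup>2 / 2)"
    by (simp add: exp_add[symmetric] power2_eq_square field_simps)
  finally have 2: "exp (- \<mu> - \<sigma> * W + \<sigma>\<^sup>2 / 2) * Phi (- W) \<le> exp (- \<sigma>\<^sup>2 / 8)"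
    using small by (meson exp_le_cancel_iff order_trans)
  have "profit \<mu> \<sigma> - exp (\<sigma>\<^sup>2 - \<mu>) =
          exp (- \<mu> - \<sigma> * W + \<sigma>\<^sup>2 / 2) * Phi (- W) - exp (\<sigma>\<^sup>2 - \<mu>) * Phi (- (W + \<sigma>))"
    by (simp only: profit_def W_def[symmetric] Let_def Phi_minus[of "W + \<sigma>"])
       (simp add: algebra_simps)
  moreover have "0 \<le> exp (- \<mu> - \<sigma> * W + \<sigma>\<^sup>2 / 2) * Phi (- W)" "0 \<le> exp (\<sigma>\<^sup>2 - \<mu>) * Phi (- (W + \<sigma>))"
    by (simp_all add: Phi_nonneg)
  ultimately show ?thesis using 1 2 by linarith
qed

text \<open>
  Inserting the censor equation into the second term of the profit turns it into
  \<open>\<Phi>(-W)\<^sup>2 + exp (-\<sigma> W + \<sigma>\<^sup>2/2) \<Phi>(W - \<sigma>) \<Phi>(-W)\<close>. The factor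
  \<open>exp (-\<sigma> W)\<close> is harmless, since the tail bound for \<open>\<Phi>(W - \<sigma>)\<close> cancels it and
  leaves \<open>exp (-W\<^sup>2/2)\<close>. The last hypothesis keeps \<open>W + \<sigma>\<close> below
  \<open>-\<mu>/(4\<sigma>)\<close>, so all the arguments at which tails are taken share one bound.
\<close>

lemma profit_small_volatility_bound:
  assumes "\<mu> > 0" "\<sigma> > 0" "normal_censor \<mu> \<sigma> \<le> - \<mu> / (2 * \<sigma>)" "\<sigma> \<le> \<mu> / (4 * \<sigma>)"
  shows "\<bar>profit \<mu> \<sigma> - 1\<bar> \<le> (exp (\<sigma>\<^sup>2) + 3) * exp (- (\<mu> / (4 * \<sigma>))\<^sup>2 / 2)"
proof -
  define W where "W = normal_censor \<mu> \<sigma>"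
  define c where "c = \<mu> / (4 * \<sigma>)"
  define \<epsilon> where "\<epsilon> = exp (- c\<^sup>2 / 2)"
  have c: "0 < c" "W + \<sigma> \<le> - c" "W \<le> - c"
    using assms by (auto simp: W_def c_def field_simps)
  have tail: "Phi x \<le> \<epsilon>" if "x \<le> - c" for x
  proof -
    have "c\<^sup>2 \<le> (- x)\<^sup>2" by (rule power_mono) (use that c in auto)
    then have "exp (- x\<^sup>2 / 2) \<le> \<epsilon>" by (simp add: \<epsilon>_def)
    then show ?thesis using Phi_le_exp[of x] that c by linarith
  qed
  let ?E = "exp (\<sigma> * W - \<sigma>\<^sup>2 / 2)" and ?R = "exp (- \<sigma> * W + \<sigma>\<^sup>2 / 2)"
  have censor: "exp (- \<mu>) = Phi (W - \<sigma>) + ?E * Phi (- W)"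
    using normal_censor_eq[OF assms(1,2)] by (simp add: W_def censor_fun_def)
  have "exp (- \<mu> - \<sigma> * W + \<sigma>\<^sup>2 / 2) * Phi (- W) = exp (- \<mu>) * ?R * Phi (- W)"
    by (simp add: exp_add[symmetric] algebra_simps)
  also have "\<dots> = ?R * Phi (W - \<sigma>) * Phi (- W) + (?E * ?R) * (Phi (- W))\<^sup>2"
    unfolding censor by (simp add: algebra_simps power2_eq_square)
  also have "?E * ?R = 1"
    by (simp add: exp_add[symmetric])
  finally have second: "exp (- \<mu> - \<sigma> * W + \<sigma>\<^sup>2 / 2) * Phi (- W) =
      ?R * Phi (W - \<sigma>) * Phi (- W) + (1 - Phi W)\<^sup>2"
    by (simp add: Phi_minus)
  have "?R * Phi (W - \<sigma>) \<le> ?R * exp (- (W - \<sigma>)\<^sup>2 / 2)"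
    by (intro mult_left_mono Phi_le_exp) (use c assms in auto)
  also have "\<dots> = exp (- W\<^sup>2 / 2)"
    by (simp add: exp_add[symmetric] power2_eq_square field_simps)
  also have "\<dots> \<le> \<epsilon>"
    using power_mono[of c "- W" 2] c by (simp add: \<epsilon>_def)
  finally have "?R * Phi (W - \<sigma>) \<le> \<epsilon>" .
  then have "?R * Phi (W - \<sigma>) * Phi (- W) \<le> \<epsilon> * 1"
    by (intro mult_mono Phi_le_1 Phi_nonneg) (auto simp: \<epsilon>_def)
  moreover have "0 \<le> ?R * Phi (W - \<sigma>) * Phi (- W)"
    by (simp add: Phi_nonneg)
  moreover have "1 - 2 * \<epsilon> \<le> (1 - Phi W)\<^sup>2"
  proof -
    have "1 - 2 * \<epsilon> \<le> 1 - 2 * Phi W + (Phi W)\<^sup>2"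
      using tail[OF c(3)] zero_le_power2[of "Phi W"] by linarith
    then show ?thesis by (simp add: power2_diff)
  qed
  moreover have "(1 - Phi W)\<^sup>2 \<le> 1"
    using Phi_nonneg[of W] Phi_le_1[of W] by (simp add: power_le_one)
  moreover have "exp (\<sigma>\<^sup>2 - \<mu>) * Phi (W + \<sigma>) \<le> exp (\<sigma>\<^sup>2) * \<epsilon>"
    by (intro mult_mono tail c Phi_nonneg) (use assms in auto)
  moreover have "0 \<le> exp (\<sigma>\<^sup>2 - \<mu>) * Phi (W + \<sigma>)"
    by (simp add: Phi_nonneg)
  moreover have "profit \<mu> \<sigma> = exp (\<sigma>\<^sup>2 - \<mu>) * Phi (W + \<sigma>) +
      (?R * Phi (W - \<sigma>) * Phi (- W) + (1 - Phi W)\<^sup>2)"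
    unfolding second[symmetric] by (simp add: profit_def Let_def W_def)
  moreover have "0 < \<epsilon>" by (simp add: \<epsilon>_def)
  ultimately have "\<bar>profit \<mu> \<sigma> - 1\<bar> \<le> exp (\<sigma>\<^sup>2) * \<epsilon> + 3 * \<epsilon>"
    by linarith
  then show ?thesis
    by (simp add: \<epsilon>_def c_def distrib_right)
qed

section \<open>Asymptotics of the profit\<close>

theorem theoremA:
  fixes \<mu> :: real
  assumes "\<mu> > 0"
  shows "((\<lambda>\<sigma>. profit \<mu> \<sigma> - exp (\<sigma>\<^sup>2 - \<mu>)) \<in> o[at_top](\<lambda>\<sigma>. 1 / \<sigma>)) \<and>
         ((\<lambda>\<sigma>. profit \<mu> \<sigma> - (exp (- \<mu>) + (1 - exp (- \<mu>)) * Phi (\<mu> / \<sigma>)))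
           \<in> o[at_right 0](\<lambda>\<sigma>. \<sigma>))"
proof
  have "eventually (\<lambda>\<sigma>. norm (profit \<mu> \<sigma> - exp (\<sigma>\<^sup>2 - \<mu>)) \<le> 1 * norm (exp (- \<sigma>\<^sup>2 / 8))) at_top"
    using eventually_normal_censor_gt[OF assms] eventually_gt_at_top[of 0]
    by eventually_elim (use profit_large_volatility_bound assms in \<open>force simp: less_imp_le\<close>)
  then have "(\<lambda>\<sigma>. profit \<mu> \<sigma> - exp (\<sigma>\<^sup>2 - \<mu>)) \<in> O[at_top](\<lambda>\<sigma>. exp (- \<sigma>\<^sup>2 / 8))"
    by (rule bigoI)
  also have "(\<lambda>\<sigma>::real. exp (- \<sigma>\<^sup>2 / 8)) \<in> o[at_top](\<lambda>\<sigma>. 1 / \<sigma>)"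
    by real_asymp
  finally show "(\<lambda>\<sigma>. profit \<mu> \<sigma> - exp (\<sigma>\<^sup>2 - \<mu>)) \<in> o[at_top](\<lambda>\<sigma>. 1 / \<sigma>)" .
next
  \<comment> \<open>With the decay rate as a single positive parameter, \<open>real_asymp\<close> can read off the sign of
     each exponent.\<close>
  define k where "k = \<mu>\<^sup>2 / 32"
  have k: "k > 0" using assms by (simp add: k_def)
  have k1: "(\<mu> / (4 * \<sigma>))\<^sup>2 / 2 = k / \<sigma>\<^sup>2" and k2: "(\<mu> / \<sigma>)\<^sup>2 / 2 = 16 * k / \<sigma>\<^sup>2" for \<sigma>
    by (simp_all add: k_def power_divide power_mult_distrib)
  let ?b = "\<lambda>\<sigma>. (exp (\<sigma>\<^sup>2) + 3) * exp (- (k / \<sigma>\<^sup>2)) + exp (- (16 * k / \<sigma>\<^sup>2))"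
  have "eventually (\<lambda>\<sigma>. \<sigma> < \<mu> / (4 * \<sigma>)) (at_right 0)"
    using assms by real_asymp
  with eventually_normal_censor_less[OF assms] eventually_at_right_less[of 0]
  have "eventually (\<lambda>\<sigma>. norm (profit \<mu> \<sigma> - (exp (- \<mu>) + (1 - exp (- \<mu>)) * Phi (\<mu> / \<sigma>)))
          \<le> 1 * norm (?b \<sigma>)) (at_right 0)"
  proof eventually_elim
    case (elim \<sigma>)
    have "exp (- \<mu>) + (1 - exp (- \<mu>)) * Phi (\<mu> / \<sigma>) = 1 - (1 - exp (- \<mu>)) * Phi (- (\<mu> / \<sigma>))"
      by (simp add: Phi_minus algebra_simps)
    moreover have "(1 - exp (- \<mu>)) * Phi (- (\<mu> / \<sigma>)) \<le> exp (- (16 * k / \<sigma>\<^sup>2))"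
    proof -
      have "(1 - exp (- \<mu>)) * Phi (- (\<mu> / \<sigma>)) \<le> 1 * exp (- (- (\<mu> / \<sigma>))\<^sup>2 / 2)"
        using assms elim by (intro mult_mono Phi_le_exp Phi_nonneg) auto
      then show ?thesis
        by (simp only: power2_minus minus_divide_left[symmetric] k2 mult_1)
    qed
    moreover have "0 \<le> (1 - exp (- \<mu>)) * Phi (- (\<mu> / \<sigma>))"
      using assms by (simp add: Phi_nonneg)
    moreover have "\<bar>profit \<mu> \<sigma> - 1\<bar> \<le> (exp (\<sigma>\<^sup>2) + 3) * exp (- (k / \<sigma>\<^sup>2))"
    proof -
      have "\<bar>profit \<mu> \<sigma> - 1\<bar> \<le> (exp (\<sigma>\<^sup>2) + 3) * exp (- (\<mu> / (4 * \<sigma>))\<^sup>2 / 2)"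
        using elim assms by (intro profit_small_volatility_bound) auto
      then show ?thesis
        by (simp only: minus_divide_left[symmetric] k1)
    qed
    ultimately have "\<bar>profit \<mu> \<sigma> - (exp (- \<mu>) + (1 - exp (- \<mu>)) * Phi (\<mu> / \<sigma>))\<bar> \<le> ?b \<sigma>"
      by linarith
    then show ?case by simp
  qed
  then have "(\<lambda>\<sigma>. profit \<mu> \<sigma> - (exp (- \<mu>) + (1 - exp (- \<mu>)) * Phi (\<mu> / \<sigma>)))
               \<in> O[at_right 0](?b)"
    by (rule bigoI)
  also have "?b \<in> o[at_right 0](\<lambda>\<sigma>. \<sigma>)"
    using k by real_asymp
  finally show "(\<lambda>\<sigma>. profit \<mu> \<sigma> - (exp (- \<mu>) + (1 - exp (- \<mu>)) * Phi (\<mu> / \<sigma>)))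
                  \<in> o[at_right 0](\<lambda>\<sigma>. \<sigma>)" .
qed

end
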